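(* For any $P\in\mathcal{P}\cup\{0\}$, we have $$\mathcal{T}^k(0)-\mathcal{T}^k(P^* )\preceq\mathcal{T}^k(P)-\mathcal{T}^k(P^* )\preceq\gamma^k(A(F^* )^T)^k(P-P^* )A(F^* )^k\quad\text{for all integers }k\ge 0,$$ where $\gamma^k(A(F^* )^T)^k(P-P^* )A(F^* )^k\to 0$ and $\mathcal{T}^k(0)-\mathcal{T}^k(P^* )\to 0$ as $k\to\infty$.
   Context: $\mathbb{S}^N$ denotes the real symmetric $N\times N$ matrices; $\mathbb{S}^N_+$, $\mathbb{S}^N_{++}$ are the positive semidefinite and positive definite ones; $\preceq,\succeq$ is the Loewner order. Fix $A\in\mathbb{R}^{n\times n}$, $B\in\mathbb{R}^{n\times m}$, a discount factor $\gamma\in(0,1]$, $Q\in\mathbb{S}^n$ with $Q\succeq 0$, $R\in\mathbb{S}^m$ with $R\succ 0$. Standing assumption: $(A,B)$ is stabilizable and $Q=C^TC$ for some matrix $C$ with $(A,C)$ detectable (discrete-time sense). Put $\Lambda=\begin{bmatrix}Q & 0 \\ 0 & R\end{bmatrix}$ and, for $F\in\mathbb{R}^{m\times n}$, $A(F)=\begin{bmatrix}A & B \\ F A & F B\end{bmatrix}\in\mathbb{R}^{(n+m)\times(n+m)}$. $X^*$ is the unique solution $X\succeq 0$ of the algebraic Riccati equation $X=\gamma A^TXA-\gamma A^TXB(R+\gamma B^TXB)^{-1}\gamma B^TXA+Q$; $F^*=-(R+\gamma B^TX^*B)^{-1}\gamma B^TX^*A$ (which satisfies $\rho(\gamma^{1/2}(A+BF^*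 ))<1$); and $P^*=\begin{bmatrix}Q+\gamma A^TX^*A & \gamma A^TX^*B \\ \gamma B^TX^*A & R+\gamma B^TX^*B\end{bmatrix}$, which satisfies $P^*=\Lambda+\gamma A(F^* )^TP^*A(F^* )$. Matrices $P\in\mathbb{S}^{n+m}$ are partitioned as $P=\begin{bmatrix}P_{11} & P_{12} \\ P_{12}^T & P_{22}\end{bmatrix}$ with $P_{11}\in\mathbb{S}^n$, $P_{12}\in\mathbb{R}^{n\times m}$, $P_{22}\in\mathbb{S}^m$. $\mathcal{P}=\{P\in\mathbb{S}^{n+m}_+:P_{22}\in\mathbb{S}^m_{++}\}$. The Bellman operator is $\mathcal{T}(P)=\Lambda+\gamma A(-P_{22}^{-1}P_{12}^T)^TPA(-P_{22}^{-1}P_{12}^T)$ for $P\in\mathcal{P}$, and $\mathcal{T}(0)=\Lambda$; it maps $\mathcal{P}\cup\{0\}$ into $\mathcal{P}$, and $\mathcal{T}^k$ is its $k$-fold composition. *)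

theory Defs
  imports "HOL-Analysis.Analysis"
begin

text \<open>
  The dimensions $n$ and $m$ are the cardinalities of the index types \<open>'n\<close> and \<open>'m\<close>; a matrix
  with $p$ rows and $q$ columns has type \<open>real^'q^'p\<close>. Block matrices are indexed by the
  sum type \<open>'n + 'm\<close>.
\<close>

subsection \<open>Symmetric matrices and the Loewner order\<close>

definition psd :: "real^'k^'k \<Rightarrow> bool" where
  "psd M \<longleftrightarrow> transpose M = M \<and> (\<forall>x. 0 \<le> x \<bullet> (M *v x))"

definition pd :: "real^'k^'k \<Rightarrow> bool" where
  "pd M \<longleftrightarrow> transpose M = M \<and> (\<forall>x. x \<noteq> 0 \<longrightarrow> 0 < x \<bullet> (M *v x))"

definition loewner_le :: "real^'k^'k \<Rightarrow> real^'k^'k \<Rightarrow> bool" (infix "\<preceq>" 50) where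
  "M \<preceq> N \<longleftrightarrow> psd (N - M)"

text \<open>The power operation of the library on type \<open>real^'k^'k\<close> acts entrywise, hence a
  separate constant for powers with respect to the matrix product.\<close>

primrec matpow :: "real^'k^'k \<Rightarrow> nat \<Rightarrow> real^'k^'k" where
  "matpow M 0 = mat 1"
| "matpow M (Suc k) = M ** matpow M k"

subsection \<open>Stabilizability and detectability in discrete time\<close>

definition complex_eigenvalue :: "real^'k^'k \<Rightarrow> complex \<Rightarrow> bool" where
  "complex_eigenvalue M z \<longleftrightarrow>
     (\<exists>v::complex^'k. v \<noteq> 0 \<and> map_matrix complex_of_real M *v v = z *s v)"

definition schur_stable :: "real^'k^'k \<Rightarrow> bool" where
  "schur_stable M \<longleftrightarrow> (\<forall>z. complex_eigenvalue M z \<longrightarrow> cmod z < 1)"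

definition stabilizable :: "real^'n^'n \<Rightarrow> real^'m^'n \<Rightarrow> bool" where
  "stabilizable A B \<longleftrightarrow> (\<exists>K::real^'n^'m. schur_stable (A + B ** K))"

definition detectable :: "real^'n^'n \<Rightarrow> real^'n^'p \<Rightarrow> bool" where
  "detectable A C \<longleftrightarrow> (\<exists>L::real^'p^'n. schur_stable (A + L ** C))"

subsection \<open>Block matrices\<close>

definition block :: "real^'n^'n \<Rightarrow> real^'m^'n \<Rightarrow> real^'n^'m \<Rightarrow> real^'m^'m
    \<Rightarrow> real^('n::finite + 'm::finite)^('n::finite + 'm::finite)" where
  "block M11 M12 M21 M22 = (\<chi> i j.
     case i of
       Inl a \<Rightarrow> (case j of Inl b \<Rightarrow> M11 $ a $ b | Inr b \<Rightarrow> M12 $ a $ b)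
     | Inr a \<Rightarrow> (case j of Inl b \<Rightarrow> M21 $ a $ b | Inr b \<Rightarrow> M22 $ a $ b))"

definition block12 :: "real^('n::finite + 'm::finite)^('n::finite + 'm::finite) \<Rightarrow> real^'m^'n" where
  "block12 P = (\<chi> i j. P $ Inl i $ Inr j)"

definition block22 :: "real^('n::finite + 'm::finite)^('n::finite + 'm::finite) \<Rightarrow> real^'m^'m" where
  "block22 P = (\<chi> i j. P $ Inr i $ Inr j)"

subsection \<open>The Riccati equation and the associated matrices\<close>

definition Lam :: "real^'n^'n \<Rightarrow> real^'m^'m \<Rightarrow> real^('n::finite + 'm::finite)^('n::finite + 'm::finite)" where
  "Lam Q R = block Q 0 0 R"

definition closed_loop :: "real^'n^'n \<Rightarrow> real^'m^'n \<Rightarrow> real^'n^'m \<Rightarrow> real^('n::finite + 'm::finite)^('n::finite + 'm::finite)" where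
  "closed_loop A B F = block A B (F ** A) (F ** B)"

definition riccati_eq :: "real^'n^'n \<Rightarrow> real^'m^'n \<Rightarrow> real \<Rightarrow> real^'n^'n \<Rightarrow> real^'m^'m
    \<Rightarrow> real^'n^'n \<Rightarrow> bool" where
  "riccati_eq A B \<gamma> Q R X \<longleftrightarrow>
     X = \<gamma> *\<^sub>R (transpose A ** X ** A)
       - (\<gamma> *\<^sub>R (transpose A ** X ** B))
           ** matrix_inv (R + \<gamma> *\<^sub>R (transpose B ** X ** B))
           ** (\<gamma> *\<^sub>R (transpose B ** X ** A))
       + Q"

definition X_star :: "real^'n^'n \<Rightarrow> real^'m^'n \<Rightarrow> real \<Rightarrow> real^'n^'n \<Rightarrow> real^'m^'m
    \<Rightarrow> real^'n^'n" where
  "X_star A B \<gamma> Q R = (THE X. psd X \<and> riccati_eq A B \<gamma> Q R X)"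

definition F_star :: "real^'n^'n \<Rightarrow> real^'m^'n \<Rightarrow> real \<Rightarrow> real^'n^'n \<Rightarrow> real^'m^'m
    \<Rightarrow> real^'n^'m" where
  "F_star A B \<gamma> Q R =
     (let X = X_star A B \<gamma> Q R in
        - (matrix_inv (R + \<gamma> *\<^sub>R (transpose B ** X ** B)) ** (\<gamma> *\<^sub>R (transpose B ** X ** A))))"

definition P_star :: "real^'n^'n \<Rightarrow> real^'m^'n \<Rightarrow> real \<Rightarrow> real^'n^'n \<Rightarrow> real^'m^'m
    \<Rightarrow> real^('n::finite + 'm::finite)^('n::finite + 'm::finite)" where
  "P_star A B \<gamma> Q R =
     (let X = X_star A B \<gamma> Q R in
        block (Q + \<gamma> *\<^sub>R (transpose A ** X ** A)) (\<gamma> *\<^sub>R (transpose A ** X ** B))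
              (\<gamma> *\<^sub>R (transpose B ** X ** A)) (R + \<gamma> *\<^sub>R (transpose B ** X ** B)))"

subsection \<open>The Bellman operator\<close>

definition calP :: "(real^('n::finite + 'm::finite)^('n::finite + 'm::finite)) set" where
  "calP = {P. psd P \<and> pd (block22 P)}"

text \<open>Only the values on \<^term>\<open>calP \<union> {0}\<close> are meaningful; note that \<^term>\<open>0\<close> is not an element
  of \<^term>\<open>calP\<close>.\<close>

definition bellman :: "real^'n^'n \<Rightarrow> real^'m^'n \<Rightarrow> real \<Rightarrow> real^'n^'n \<Rightarrow> real^'m^'m
    \<Rightarrow> real^('n::finite + 'm::finite)^('n::finite + 'm::finite) \<Rightarrow> real^('n::finite + 'm::finite)^('n::finite + 'm::finite)" where
  "bellman A B \<gamma> Q R P =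
     (if P = 0 then Lam Q R
      else (let M = closed_loop A B (- (matrix_inv (block22 P) ** transpose (block12 P)))
            in Lam Q R + \<gamma> *\<^sub>R (transpose M ** P ** M)))"

end

theory Submission
  imports Defs "HOL-Computational_Algebra.Fundamental_Theorem_Algebra"
begin

text \<open>
  Write \<open>qf P z = z \<bullet> (P *v z)\<close> with \<open>z\<close> the stacked pair of a state \<open>x\<close> and an input \<open>u\<close>.
  Completing the square in the input shows that
  \<open>qf (T P) z = qf \<Lambda> z + \<gamma> * min\<^sub>v qf P (y, v)\<close> with \<open>y = A x + B u\<close>
  (\<open>qf_bellman\<close>, \<open>min_value_le\<close>), and at \<open>P = 0\<close> the same formula gives \<open>T 0 = \<Lambda>\<close>.
  So \<open>T ^^ k\<close> computes the optimal cost over \<open>k\<close> stages with terminal cost \<open>P\<close>, and both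
  inequalities follow from properties of a minimum. The minimum is monotone in \<open>P\<close>
  and \<open>0 \<preceq> P\<close>, which gives the lower bound. Replacing the minimiser by the fixed policy
  \<open>F\<^sup>*\<close> can only increase the cost and changes nothing at the fixed point \<open>P\<^sup>*\<close>, whence
  \<open>T P - P\<^sup>* \<preceq> \<gamma> M\<^sup>T (P - P\<^sup>*) M\<close> with \<open>M = A(F\<^sup>*)\<close>; iterating this gives the upper bound
  (\<open>bellman_pow_diff_le\<close>).

  What remains is the Riccati theory behind \<open>P\<^sup>*\<close> and the two limits.

  Existence: the iterates \<open>(T ^^ k) 0\<close> increase, and stabilizability bounds them by the
  cost of a stabilizing policy, which is obtained as the solution of a Lyapunov equation
  (\<open>lyapunov_solution\<close>). They therefore converge, and their limit is a fixed point of \<open>T\<close>,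
  because the minimisers stay in a bounded set (\<open>value_iteration_converges\<close>). The Schur
  complement of a fixed point in \<open>calP\<close> solves the Riccati equation
  (\<open>riccati_of_fixed_point\<close>).

  Stability: along the closed loop of any positive semidefinite Riccati solution the
  stage costs are summable, so \<open>C x\<^sub>k\<close> and \<open>F x\<^sub>k\<close> tend to \<open>0\<close>. By detectability
  \<open>x\<^sub>k\<^sub>+\<^sub>1 = (A + L C) x\<^sub>k + w\<^sub>k\<close> with \<open>A + L C\<close> stable and \<open>w\<^sub>k\<close> tending to \<open>0\<close>, and
  so \<open>x\<^sub>k\<close> tends to \<open>0\<close> (\<open>riccati_stabilizing\<close>; the factor \<open>sqrt \<gamma>\<close> is absorbed into
  the matrices). This also makes the powers of \<open>sqrt \<gamma> A(F\<^sup>*)\<close> vanish.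

  Uniqueness: comparing the costs of two solutions along the closed loop of one of them
  shows that each lies below the other (\<open>riccati_le\<close>). Hence \<open>P\<^sup>*\<close> is the limit of
  \<open>(T ^^ k) 0\<close>, which is the last claim.

  The passage from eigenvalues in the unit disc to vanishing trajectories
  (\<open>schur_stable_vanishing_input\<close>) uses an annihilating polynomial of the matrix, from which
  the linear factors are removed one at a time.
\<close>

section \<open>Schur stable systems with vanishing input\<close>

text \<open>
  From the index at which \<open>e\<close> has fallen below \<open>d * (1 - c)\<close>, the recursion keeps \<open>a\<close> below a
  geometric sequence plus \<open>d\<close>, since \<open>d\<close> is the fixed point of \<open>t \<mapsto> c * t + d * (1 - c)\<close>.
\<close>

lemma contraction_vanishing_input:
  fixes a e :: "nat \<Rightarrow> real"
  assumes c: "0 \<le> c" "c < 1" and nonneg: "\<And>k. 0 \<le> a k"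
    and step: "\<And>k. a (Suc k) \<le> c * a k + e k" and e: "e \<longlonglongrightarrow> 0"
  shows "a \<longlonglongrightarrow> 0"
proof (rule LIMSEQ_I)
  fix r :: real assume r: "0 < r"
  define d where "d = r / 2"
  have d: "0 < d" using r by (simp add: d_def)
  have "0 < d * (1 - c)" using d c by simp
  then obtain K where K: "\<And>k. k \<ge> K \<Longrightarrow> norm (e k - 0) < d * (1 - c)"
    using LIMSEQ_D[OF e] by blast
  have tail: "a (K + j) \<le> c ^ j * a K + d" for j
  proof (induction j)
    case 0 then show ?case using d by simp
  next
    case (Suc j)
    have "a (K + Suc j) \<le> c * a (K + j) + e (K + j)" using step[of "K + j"] by simp
    also have "\<dots> \<le> c * (c ^ j * a K + d) + d * (1 - c)"
      using mult_left_mono[OF Suc c(1)] K[of "K + j"] by (simp add: abs_less_iff)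
    also have "\<dots> = c ^ Suc j * a K + d" by (simp add: algebra_simps)
    finally show ?case .
  qed
  have "(\<lambda>j. c ^ j * a K) \<longlonglongrightarrow> 0"
    using tendsto_mult_left_zero[OF LIMSEQ_power_zero[of c]] c by simp
  then obtain J where J: "\<And>j. j \<ge> J \<Longrightarrow> norm (c ^ j * a K - 0) < d"
    using d LIMSEQ_D by blast
  show "\<exists>no. \<forall>n\<ge>no. norm (a n - 0) < r"
  proof (intro exI allI impI)
    fix n assume n: "n \<ge> K + J"
    have "a n \<le> c ^ (n - K) * a K + d" using tail[of "n - K"] n by simp
    also have "\<dots> < d + d" using J[of "n - K"] n by (simp add: abs_less_iff)
    finally show "norm (a n - 0) < r" using nonneg[of n] by (simp add: d_def)
  qed
qed

lemma complex_matrix_vector_scaleR: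
  fixes M :: "complex^'k^'k"
  shows "M *v (r *\<^sub>R x) = r *\<^sub>R (M *v x)"
  by (simp add: vec_eq_iff matrix_vector_mult_def scaleR_sum_right)

text \<open>
  A single linear factor \<open>M - a\<close> can be cancelled, for one of two reasons. If \<open>\<bar>a\<bar> < 1\<close>, the
  trajectory obeys \<open>x\<^sub>k\<^sub>+\<^sub>1 = a x\<^sub>k + o(1)\<close> and contracts. Otherwise \<open>a\<close> is not an eigenvalue, so
  \<open>M - a\<close> is injective and hence bounded below.
\<close>

lemma eigen_factor_vanishing:
  fixes M :: "complex^'k::finite^'k" and x w :: "nat \<Rightarrow> complex^'k"
  assumes ev: "\<And>v. M *v v = a *s v \<Longrightarrow> v \<noteq> 0 \<Longrightarrow> cmod a < 1"
    and step: "\<And>k. x (Suc k) = M *v x k + w k" and w: "w \<longlonglongrightarrow> 0"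
    and y: "(\<lambda>k. M *v x k - a *s x k) \<longlonglongrightarrow> 0"
  shows "x \<longlonglongrightarrow> 0"
proof (cases "cmod a < 1")
  case True
  define e where "e k = norm (M *v x k - a *s x k) + norm (w k)" for k
  have "e \<longlonglongrightarrow> 0"
    unfolding e_def using tendsto_add[OF tendsto_norm[OF y] tendsto_norm[OF w]] by simp
  moreover have "norm (x (Suc k)) \<le> cmod a * norm (x k) + e k" for k
  proof -
    have n: "norm (a *s x k) = cmod a * norm (x k)"
      by (simp add: norm_vec_def norm_mult L2_set_right_distrib)
    have "norm (x (Suc k)) = norm (a *s x k + (M *v x k - a *s x k) + w k)" by (simp add: step)
    then have "norm (x (Suc k)) \<le> norm (a *s x k) + norm (M *v x k - a *s x k) + norm (w k)"
      using norm_triangle_ineq[of "a *s x k + (M *v x k - a *s x k)" "w k"]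
        norm_triangle_ineq[of "a *s x k" "M *v x k - a *s x k"] by linarith
    then show ?thesis by (simp add: n e_def)
  qed
  ultimately have "(\<lambda>k. norm (x k)) \<longlonglongrightarrow> 0"
    using contraction_vanishing_input[of "cmod a" "\<lambda>k. norm (x k)" e] True by simp
  then show ?thesis by (rule tendsto_norm_zero_cancel)
next
  case False
  define f where "f v = M *v v - a *s v" for v
  have lin: "linear f"
    by (rule linearI)
       (auto simp: f_def matrix_vector_right_distrib vector_add_ldistrib complex_matrix_vector_scaleR
          algebra_simps vec_eq_iff)
  have "inj f"
    unfolding linear_injective_0[OF lin] using ev False by (auto simp: f_def)
  then obtain b where b: "b > 0" "\<And>v. b * norm v \<le> norm (f v)"
    using linear_inj_bounded_below_pos[OF lin] by blast
  have "(\<lambda>k. norm (f (x k)) / b) \<longlonglongrightarrow> 0"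
    using tendsto_divide[OF tendsto_norm[OF y] tendsto_const[of b]] b(1) by (simp add: f_def)
  then show ?thesis
    by (rule Lim_null_comparison[rotated])
       (use b in \<open>auto simp: field_simps\<close>)
qed

text \<open>
  This is \<open>p(M) v\<close> whenever \<open>n \<ge> degree p\<close>. The summation bound is a separate argument so
  that polynomials of different degrees can be compared term by term.
\<close>

definition poly_action :: "nat \<Rightarrow> complex poly \<Rightarrow> complex^'k^'k \<Rightarrow> complex^'k \<Rightarrow> complex^'k" where
  "poly_action n p M v = (\<Sum>i\<le>n. coeff p i *s (((*v) M ^^ i) v))"

lemma complex_matrix_vector_sum: 
  fixes M :: "complex^'k^'l"
  shows "M *v (\<Sum>i\<in>S. f i) = (\<Sum>i\<in>S. M *v f i)"
  by (induction S rule: infinite_finite_induct) (auto simp: matrix_vector_right_distrib)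

lemma matrix_funpow_add: "((*v) M ^^ i) (x + y) = ((*v) M ^^ i) x + ((*v) M ^^ i) y"
  for M :: "complex^'k^'k"
  by (induction i) (auto simp: matrix_vector_right_distrib)

text \<open>
  Since \<open>p(M)\<close> commutes with \<open>M\<close>, it maps a driven trajectory of \<open>M\<close> to another one; the
  induction on the degree applies to this new trajectory.
\<close>

lemma poly_action_step:
  "poly_action n p M (M *v x + w) = M *v poly_action n p M x + poly_action n p M w"
proof -
  have "((*v) M ^^ i) (M *v x) = M *v (((*v) M ^^ i) x)" for i
    by (metis funpow_swap1)
  then show ?thesis
    by (simp add: poly_action_def matrix_funpow_add vector_add_ldistrib sum.distrib
       complex_matrix_vector_sum vector_scalar_commute)
qed

lemma poly_action_linear_factor:
  assumes "degree q < n"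
  shows "poly_action n ([:-a, 1:] * q) M v
    = M *v poly_action n q M v - a *s poly_action n q M v"
proof -
  obtain m where m: "n = Suc m" using assms by (cases n) auto
  have top: "coeff q (Suc m) = 0" using assms m coeff_eq_0 by auto
  have "[:-a, 1:] * q = pCons 0 q - smult a q" by simp
  then have "coeff ([:-a, 1:] * q) i = coeff (pCons 0 q) i - a * coeff q i" for i
    by (metis coeff_diff coeff_smult)
  then have "poly_action n ([:-a, 1:] * q) M v
      = (\<Sum>i\<le>Suc m. coeff (pCons 0 q) i *s (((*v) M ^^ i) v)) - a *s poly_action n q M v"
    by (simp only: poly_action_def m)
       (simp only: vector_ssub_ldistrib vec.scale_sum_right vec.scale_scale
          vec.scale_left_diff_distrib sum_subtractf)
  also have "(\<Sum>i\<le>Suc m. coeff (pCons 0 q) i *s (((*v) M ^^ i) v)) = M *v poly_action n q M v"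
  proof -
    have "poly_action n q M v = (\<Sum>i\<le>m. coeff q i *s (((*v) M ^^ i) v))"
      by (simp add: poly_action_def m top)
    then show ?thesis
      unfolding sum.atMost_Suc_shift by (simp add: complex_matrix_vector_sum vector_scalar_commute)
  qed
  finally show ?thesis .
qed

lemma poly_action_tendsto_0:
  assumes "x \<longlonglongrightarrow> 0" shows "(\<lambda>k. poly_action n p M (x k)) \<longlonglongrightarrow> 0"
proof -
  have lin: "linear (poly_action n p M)"
  proof (rule linearI)
    fix r x
    have "((*v) M ^^ i) (r *\<^sub>R x) = r *\<^sub>R ((*v) M ^^ i) x" for i
      by (induction i) (auto simp: complex_matrix_vector_scaleR)
    then show "poly_action n p M (r *\<^sub>R x) = r *\<^sub>R poly_action n p M x"
      by (simp add: poly_action_def scaleR_sum_right vec_eq_iff)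
  qed (simp add: poly_action_def matrix_funpow_add vector_add_ldistrib sum.distrib)
  show ?thesis
    using bounded_linear.tendsto[OF linear_conv_bounded_linear[THEN iffD1, OF lin] assms]
    by (simp add: linear_0[OF lin])
qed

text \<open>
  Induction on the degree: a root \<open>a\<close> of \<open>p = (X - a) q\<close> makes \<open>y = q(M) x\<close> a driven
  trajectory with \<open>(M - a) y\<close> vanishing, so \<open>y\<close> vanishes, and \<open>q\<close> has smaller degree.
\<close>

lemma poly_action_vanishing:
  fixes M :: "complex^'k::finite^'k" and x w :: "nat \<Rightarrow> complex^'k"
  assumes ev: "\<And>a v. M *v v = a *s v \<Longrightarrow> v \<noteq> 0 \<Longrightarrow> cmod a < 1"
    and step: "\<And>k. x (Suc k) = M *v x k + w k" and w: "w \<longlonglongrightarrow> 0"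
  shows "p \<noteq> 0 \<Longrightarrow> degree p \<le> n \<Longrightarrow> (\<lambda>k. poly_action n p M (x k)) \<longlonglongrightarrow> 0 \<Longrightarrow> x \<longlonglongrightarrow> 0"
proof (induction "degree p" arbitrary: p)
  case 0
  then obtain c where p: "p = [:c:]" "c \<noteq> 0" by (metis degree_eq_zeroE pCons_0_0)
  have "poly_action n p M v = c *s v" for v
    by (simp add: poly_action_def p coeff_pCons sum.atMost_shift)
  then have "(\<lambda>k. norm (c *s x k) / cmod c) \<longlonglongrightarrow> 0"
    using tendsto_divide[OF tendsto_norm[OF 0(4)] tendsto_const[of "cmod c"]] p(2) by simp
  then have "(\<lambda>k. norm (x k)) \<longlonglongrightarrow> 0"
    using p(2) by (simp add: norm_vec_def norm_mult L2_set_right_distrib[symmetric])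
  then show ?case by (rule tendsto_norm_zero_cancel)
next
  case (Suc d)
  have "\<not> constant (poly p)" using Suc(2) by (simp add: constant_degree)
  then obtain a where "poly p a = 0" using fundamental_theorem_of_algebra by blast
  then obtain q where q: "p = [:-a, 1:] * q" by (auto simp: poly_eq_0_iff_dvd)
  have q0: "q \<noteq> 0" using q Suc by auto
  have dq: "degree p = Suc (degree q)" unfolding q using q0 by (subst degree_mult_eq) auto
  define y where "y k = poly_action n q M (x k)" for k
  have y0: "(\<lambda>k. M *v y k - a *s y k) \<longlonglongrightarrow> 0"
    using Suc(5) dq Suc(4) unfolding y_def q
    by (subst poly_action_linear_factor[symmetric]) auto
  have ystep: "y (Suc k) = M *v y k + poly_action n q M (w k)" for k
    by (simp add: y_def step poly_action_step)
  have "y \<longlonglongrightarrow> 0"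
    by (rule eigen_factor_vanishing[OF _ ystep poly_action_tendsto_0[OF w] y0]) (rule ev)
  then show ?case
    using Suc(1)[of q] dq Suc(2,4) q0 by (simp add: y_def[abs_def])
qed

text \<open>
  More powers of \<open>M\<close> than the dimension of the matrix space either repeat or are linearly
  dependent; the two cases are separated because a repetition is invisible in the set of
  powers.
\<close>

lemma annihilating_polynomial:
  fixes M :: "real^'k::finite^'k"
  obtains c :: "nat \<Rightarrow> real" and n i where "i \<le> n" "c i \<noteq> 0"
    "(\<Sum>i\<le>n. c i *\<^sub>R matpow M i) = 0"
proof (cases "inj_on (matpow M) {..DIM(real^'k^'k)}")
  case True
  let ?S = "matpow M ` {..DIM(real^'k^'k)}"
  have "card ?S > DIM(real^'k^'k)" using True by (simp add: card_image)
  then have "dependent ?S" using dependent_biggerset by blast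
  then obtain u v where u: "v \<in> ?S" "u v \<noteq> 0" "(\<Sum>v\<in>?S. u v *\<^sub>R v) = 0"
    unfolding dependent_finite[OF finite_imageI[OF finite_atMost]] by blast
  then obtain i where i: "i \<le> DIM(real^'k^'k)" "v = matpow M i" by auto
  have "(\<Sum>i\<le>DIM(real^'k^'k). u (matpow M i) *\<^sub>R matpow M i) = 0"
    using u(3) unfolding sum.reindex[OF True] o_def .
  then show ?thesis
    using i(1) u(2)[unfolded i(2)] by (intro that[of i "DIM(real^'k^'k)" "\<lambda>i. u (matpow M i)"])
next
  case False
  then obtain i j where ij: "i < j" "matpow M i = matpow M j"
    unfolding inj_on_def by (metis linorder_neqE_nat)
  define c :: "nat \<Rightarrow> real" where "c l = (if l = i then 1 else 0) - (if l = j then 1 else 0)" for l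
  have "(\<Sum>l\<le>j. c l *\<^sub>R matpow M l)
      = (\<Sum>l\<le>j. (if l = i then matpow M l else 0) - (if l = j then matpow M l else 0))"
    by (rule sum.cong) (auto simp: c_def)
  also have "\<dots> = matpow M i - matpow M j"
    unfolding sum_subtractf using ij(1) by (simp only: sum.delta finite_atMost atMost_iff) simp
  finally show ?thesis using ij by (intro that[of i j c]) (auto simp: c_def)
qed

text \<open>
  Taking \<open>w = 0\<close> gives convergence of the powers of \<open>M\<close>; the version with an input is what
  detectability needs, and the induction over linear factors produces such inputs anyway.
\<close>

lemma schur_stable_vanishing_input:
  fixes M :: "real^'k::finite^'k" and x w :: "nat \<Rightarrow> real^'k"
  assumes M: "schur_stable M"
    and step: "\<And>k. x (Suc k) = M *v x k + w k" and w: "w \<longlonglongrightarrow> 0"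
  shows "x \<longlonglongrightarrow> 0"
proof -
  obtain c :: "nat \<Rightarrow> real" and n i where c: "i \<le> n" "c i \<noteq> 0"
    "(\<Sum>i\<le>n. c i *\<^sub>R matpow M i) = 0"
    by (rule annihilating_polynomial)
  define p where "p = (\<Sum>i\<le>n. monom (complex_of_real (c i)) i)"
  have coeff_p: "coeff p j = (if j \<le> n then of_real (c j) else 0)" for j
    by (simp add: p_def coeff_sum)
  define cv :: "real^'k \<Rightarrow> complex^'k" where "cv v = (\<chi> i. of_real (v $ i))" for v
  define N where "N = map_matrix complex_of_real M"
  have cv_mult: "N *v cv v = cv (M *v v)" for v
    by (simp add: N_def cv_def matrix_vector_mult_def vec_eq_iff)
  have cv_add: "cv (v + u) = cv v + cv u" for v u by (simp add: cv_def vec_eq_iff)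
  have pow: "((*v) N ^^ i) (cv v) = cv (matpow M i *v v)" for i v
    by (induction i) (auto simp: cv_mult matrix_vector_mul_assoc)
  have cv_sum: "(\<Sum>i\<le>j. of_real (c i) *s cv (matpow M i *v v))
      = cv ((\<Sum>i\<le>j. c i *\<^sub>R matpow M i) *v v)" for v j
    by (induction j)
       (auto simp: cv_add matrix_vector_mult_add_rdistrib scaleR_matrix_vector_assoc[symmetric]
          cv_def vec_eq_iff)
  have ann: "poly_action n p N (cv v) = 0" for v
  proof -
    have "poly_action n p N (cv v) = (\<Sum>i\<le>n. of_real (c i) *s cv (matpow M i *v v))"
      by (simp add: poly_action_def pow coeff_p)
    also have "\<dots> = 0" unfolding cv_sum c(3) by (simp add: cv_def vec_eq_iff)
    finally show ?thesis .
  qed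
  have norm_cv: "norm (cv v) = norm v" for v
    by (simp add: cv_def norm_vec_def)
  have ev: "cmod a < 1" if "N *v v = a *s v" "v \<noteq> 0" for a v
    using M that unfolding schur_stable_def complex_eigenvalue_def N_def
    by (elim allE[of _ a]) auto
  have cv_step: "cv (x (Suc k)) = N *v cv (x k) + cv (w k)" for k
    unfolding step cv_add cv_mult by (rule refl)
  have cv_w: "(\<lambda>k. cv (w k)) \<longlonglongrightarrow> 0"
    using tendsto_norm[OF w] by (intro tendsto_norm_zero_cancel[of "\<lambda>k. cv (w k)"]) (simp add: norm_cv)
  have "p \<noteq> 0" using c(1,2) coeff_p[of i] by auto
  moreover have "degree p \<le> n" by (rule degree_le) (simp add: coeff_p)
  moreover have "(\<lambda>k. poly_action n p N (cv (x k))) \<longlonglongrightarrow> 0" unfolding ann by (rule tendsto_const)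
  ultimately have "(\<lambda>k. cv (x k)) \<longlonglongrightarrow> 0"
    by (rule poly_action_vanishing[OF _ cv_step cv_w, rotated 1]) (rule ev)
  then have "(\<lambda>k. norm (x k)) \<longlonglongrightarrow> 0"
    using tendsto_norm[of "\<lambda>k. cv (x k)" 0 sequentially] by (simp add: norm_cv)
  then show ?thesis by (rule tendsto_norm_zero_cancel)
qed

lemma schur_stable_scaleR:
  fixes M :: "real^'k::finite^'k"
  assumes "schur_stable M" "0 < c" "c \<le> 1"
  shows "schur_stable (c *\<^sub>R M)"
  unfolding schur_stable_def
proof (intro allI impI)
  fix z assume "complex_eigenvalue (c *\<^sub>R M) z"
  then obtain v :: "complex^'k" where v: "v \<noteq> 0" "map_matrix complex_of_real (c *\<^sub>R M) *v v = z *s v"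
    unfolding complex_eigenvalue_def by blast
  have "map_matrix complex_of_real (c *\<^sub>R M) *v v = of_real c *s (map_matrix complex_of_real M *v v)"
    by (simp add: vec_eq_iff matrix_vector_mult_def sum_distrib_left mult.assoc)
  then have "map_matrix complex_of_real M *v v = (z / of_real c) *s v"
    using arg_cong[OF v(2), of "\<lambda>y. (1 / of_real c) *s y"] assms(2)
    by (simp add: vector_smult_assoc)
  then have "cmod (z / of_real c) < 1"
    using assms(1) v(1) unfolding schur_stable_def complex_eigenvalue_def
    by (elim allE[of _ "z / of_real c"]) auto
  then show "cmod z < 1" using assms(2,3) by (simp add: norm_divide field_simps)
qed

section \<open>Quadratic forms and symmetric matrices\<close>

definition qf :: "real^'k^'k \<Rightarrow> real^'k \<Rightarrow> real" where
  "qf M x = x \<bullet> (M *v x)"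

lemma uminus_matrix_vector: "(- M) *v x = - (M *v x)" for M :: "real^'k^'l"
  by (simp add: vec_eq_iff matrix_vector_mult_def sum_negf)

lemma inner_transpose: "x \<bullet> (transpose N *v y) = (N *v x) \<bullet> y" for N :: "real^'k^'l"
  by (metis dot_lmul_matrix inner_commute transpose_matrix_vector)

lemma transpose_add: "transpose (M + N) = transpose M + transpose N" for M :: "real^'k^'l"
  by (simp add: transpose_def vec_eq_iff)

lemma transpose_diff: "transpose (M - N) = transpose M - transpose N" for M :: "real^'k^'l"
  by (simp add: transpose_def vec_eq_iff)

lemma transpose_zero [simp]: "transpose (0 :: real^'k^'l) = 0"
  by (simp add: transpose_def vec_eq_iff)

lemma transpose_sandwich:
  fixes X :: "real^'k^'k" and M :: "real^'i^'k" and N :: "real^'j^'k"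
  assumes "transpose X = X"
  shows "transpose (transpose M ** X ** N) = transpose N ** X ** M"
  by (simp add: matrix_transpose_mul assms matrix_mul_assoc)

lemma transpose_congruence:
  fixes M :: "real^'k^'k" and N :: "real^'l^'k"
  assumes "transpose M = M"
  shows "transpose (transpose N ** M ** N) = transpose N ** M ** N"
  by (simp add: matrix_transpose_mul assms matrix_mul_assoc)

lemma qf_add: "qf (M + N) x = qf M x + qf N x"
  by (simp add: qf_def matrix_vector_mult_add_rdistrib inner_add_right)

lemma qf_diff: "qf (M - N) x = qf M x - qf N x"
  by (simp add: qf_def matrix_vector_mult_diff_rdistrib inner_diff_right)

lemma qf_scaleR: "qf (c *\<^sub>R M) x = c * qf M x"
  by (simp add: qf_def scaleR_matrix_vector_assoc[symmetric])

lemma qf_scaleR_vector: "qf M (c *\<^sub>R x) = c\<^sup>2 * qf M x"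
  by (simp add: qf_def matrix_vector_mult_scaleR power2_eq_square)

lemma qf_congruence: "qf (transpose N ** M ** N) x = qf M (N *v x)"
  by (simp add: qf_def matrix_vector_mul_assoc[symmetric] inner_transpose del: transpose_matrix_vector)

lemma qf_zero [simp]: "qf 0 x = 0" "qf M 0 = 0"
  by (simp_all add: qf_def)

lemma psd_qf: "psd M \<longleftrightarrow> transpose M = M \<and> (\<forall>x. 0 \<le> qf M x)"
  by (simp add: psd_def qf_def)

lemma pd_qf: "pd M \<longleftrightarrow> transpose M = M \<and> (\<forall>x. x \<noteq> 0 \<longrightarrow> 0 < qf M x)"
  by (simp add: pd_def qf_def)

lemma pd_imp_psd: "pd M \<Longrightarrow> psd M"
  unfolding psd_qf pd_qf using order_less_imp_le qf_zero(2) order_refl by metis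

lemma loewner_qf:
  assumes "transpose M = M" "transpose N = N"
  shows "M \<preceq> N \<longleftrightarrow> (\<forall>x. qf M x \<le> qf N x)"
  using assms by (simp add: loewner_le_def psd_qf transpose_diff qf_diff)

lemma qf_shift:
  assumes "transpose M = M"
  shows "qf M (x + y) = qf M x + 2 * (y \<bullet> (M *v x)) + qf M y"
proof -
  have "x \<bullet> (M *v y) = y \<bullet> (M *v x)"
    using inner_transpose[of x M y] assms by (simp add: inner_commute del: transpose_matrix_vector)
  then show ?thesis
    by (simp add: qf_def matrix_vector_right_distrib inner_add_left inner_add_right)
qed

text \<open>
  Polarisation lets the whole development work with quadratic forms: equality and
  convergence of symmetric matrices may be checked form by form.
\<close>

lemma polarization_entry:
  fixes M :: "real^'k::finite^'k"
  assumes "transpose M = M"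
  shows "M $ i $ j = (qf M (axis i 1 + axis j 1) - qf M (axis i 1) - qf M (axis j 1)) / 2"
proof -
  have "axis i 1 \<bullet> (M *v axis j 1) = M $ i $ j"
    by (simp add: inner_axis' matrix_vector_mult_basis column_def)
  then show ?thesis
    using qf_shift[OF assms, of "axis j 1" "axis i 1"] by (simp add: add.commute)
qed

lemma symmetric_eqI:
  fixes M :: "real^'k::finite^'k"
  assumes "transpose M = M" "transpose N = N" "\<And>x. qf M x = qf N x"
  shows "M = N"
  unfolding vec_eq_iff polarization_entry[OF assms(1)] polarization_entry[OF assms(2)] assms(3)
  by simp

lemma vec_tendsto_componentwise:
  "S \<longlonglongrightarrow> L \<longleftrightarrow> (\<forall>i j. (\<lambda>k. S k $ i $ j) \<longlonglongrightarrow> L $ i $ j)" for L :: "real^'l^'k"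
  by (metis tendsto_vec_nth vec_tendstoI)

lemma symmetric_tendstoI:
  fixes S :: "nat \<Rightarrow> real^'k::finite^'k"
  assumes "\<And>k. transpose (S k) = S k" "transpose L = L" "\<And>x. (\<lambda>k. qf (S k) x) \<longlonglongrightarrow> qf L x"
  shows "S \<longlonglongrightarrow> L"
  unfolding vec_tendsto_componentwise
  unfolding polarization_entry[OF assms(1)] polarization_entry[OF assms(2)]
  by (intro allI tendsto_divide tendsto_diff assms(3) tendsto_const) simp

lemma symmetric_limit_exists:
  fixes S :: "nat \<Rightarrow> real^'k::finite^'k"
  assumes sym: "\<And>k. transpose (S k) = S k" and conv: "\<And>x. convergent (\<lambda>k. qf (S k) x)"
  obtains L where "transpose L = L" "S \<longlonglongrightarrow> L" "\<And>x. (\<lambda>k. qf (S k) x) \<longlonglongrightarrow> qf L x"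
proof -
  have "\<exists>l. (\<lambda>k. S k $ i $ j) \<longlonglongrightarrow> l" for i j
  proof -
    have "convergent (\<lambda>k. (qf (S k) (axis i 1 + axis j 1) - qf (S k) (axis i 1)
        - qf (S k) (axis j 1)) * (1/2))"
      by (intro convergent_mult convergent_diff conv convergent_const)
    then show ?thesis by (simp add: convergent_def polarization_entry[OF sym])
  qed
  then obtain l where l: "\<And>i j. (\<lambda>k. S k $ i $ j) \<longlonglongrightarrow> l i j" by metis
  define L where "L = (\<chi> i j. l i j)"
  have SL: "S \<longlonglongrightarrow> L" by (intro vec_tendstoI) (simp add: L_def l)
  have "S k $ i $ j = S k $ j $ i" for k i j
    using arg_cong[OF sym[of k], of "\<lambda>M. M $ i $ j"] by (simp add: transpose_def)
  then have "l i j = l j i" for i j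
    using LIMSEQ_unique[OF l[of i j]] l[of j i] by simp
  then have symL: "transpose L = L" by (simp add: L_def transpose_def)
  have "(\<lambda>k. qf (S k) x) \<longlonglongrightarrow> qf L x" for x
    unfolding qf_def inner_vec_def matrix_vector_mult_def
    using SL by (auto simp: vec_tendsto_componentwise intro!: tendsto_sum tendsto_mult tendsto_const)
  then show ?thesis using that SL symL by blast
qed

lemma pd_bounded_below:
  fixes M :: "real^'k::finite^'k"
  assumes "pd M"
  obtains r where "0 < r" "\<And>x. r * (norm x)\<^sup>2 \<le> qf M x"
proof -
  let ?S = "sphere (0::real^'k) 1"
  have "continuous_on ?S (qf M)"
    unfolding qf_def by (intro continuous_intros linear_continuous_on matrix_vector_mul_bounded_linear)
  moreover have "axis undefined 1 \<in> ?S" by simp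
  ultimately obtain x0 where x0: "x0 \<in> ?S" "\<And>x. x \<in> ?S \<Longrightarrow> qf M x0 \<le> qf M x"
    using continuous_attains_inf[OF compact_sphere, of 0 1 "qf M"] by blast
  have "x0 \<noteq> 0" using x0(1) by auto
  then have pos: "0 < qf M x0" using assms by (simp add: pd_qf)
  have "qf M x0 * (norm x)\<^sup>2 \<le> qf M x" for x
  proof (cases "x = 0")
    case False
    have "qf M x = (norm x)\<^sup>2 * qf M ((1 / norm x) *\<^sub>R x)"
      using False by (simp add: qf_scaleR_vector field_simps power_divide)
    moreover have "qf M x0 \<le> qf M ((1 / norm x) *\<^sub>R x)" using x0(2) False by simp
    ultimately show ?thesis
      using mult_right_mono[OF _ zero_le_power2[of "norm x"]] by (simp add: mult.commute[of "(norm x)\<^sup>2"])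
  qed simp
  then show ?thesis using that pos by blast
qed

lemma pd_matrix_inv:
  fixes M :: "real^'k::finite^'k"
  assumes "pd M"
  shows "M ** matrix_inv M = mat 1"
proof -
  have "\<forall>x. M *v x = 0 \<longrightarrow> x = 0" using assms unfolding pd_def by (metis inner_zero_right less_irrefl)
  then have "invertible M"
    using invertible_left_inverse matrix_left_invertible_ker by blast
  then show "M ** matrix_inv M = mat 1"
    unfolding invertible_def matrix_inv_def using someI_ex[of "\<lambda>A'. M ** A' = mat 1 \<and> A' ** M = mat 1"]
    by auto
qed

lemma transpose_matrix_inv_pd:
  fixes M :: "real^'k::finite^'k"
  assumes "pd M"
  shows "transpose (matrix_inv M) = matrix_inv M"
proof -
  have "transpose (matrix_inv M) ** M = mat 1"
    using arg_cong[OF pd_matrix_inv[OF assms], of transpose] assms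
    by (simp add: matrix_transpose_mul pd_def)
  then show ?thesis
    by (metis assms matrix_mul_assoc matrix_mul_lid matrix_mul_rid pd_matrix_inv)
qed

section \<open>Stacked vectors and minimisation over the input\<close>

definition vjoin :: "real^'n::finite \<Rightarrow> real^'m::finite \<Rightarrow> real^('n + 'm)" where
  "vjoin x u = (\<chi> i. case i of Inl a \<Rightarrow> x $ a | Inr b \<Rightarrow> u $ b)"

definition upper :: "real^('n::finite + 'm::finite) \<Rightarrow> real^'n" where
  "upper z = (\<chi> a. z $ Inl a)"

definition lower :: "real^('n::finite + 'm::finite) \<Rightarrow> real^'m" where
  "lower z = (\<chi> b. z $ Inr b)"

lemma upper_vjoin [simp]: "upper (vjoin x u) = x" and lower_vjoin [simp]: "lower (vjoin x u) = u"
  by (simp_all add: upper_def lower_def vjoin_def)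

lemma vjoin_upper_lower [simp]: "vjoin (upper z) (lower z) = z"
  by (simp add: upper_def lower_def vjoin_def vec_eq_iff split: sum.split)

lemma sum_Plus_UNIV: "(\<Sum>i\<in>UNIV. f i) = (\<Sum>a\<in>UNIV. f (Inl a)) + (\<Sum>b\<in>UNIV. f (Inr b))"
  for f :: "'n::finite + 'm::finite \<Rightarrow> real"
  unfolding UNIV_Plus_UNIV[symmetric] by (subst sum.Plus) auto

lemma inner_vjoin: "vjoin x u \<bullet> z = x \<bullet> upper z + u \<bullet> lower z"
  by (simp add: inner_vec_def sum_Plus_UNIV vjoin_def upper_def lower_def)

lemma block_vjoin: "block M11 M12 M21 M22 *v vjoin x u = vjoin (M11 *v x + M12 *v u) (M21 *v x + M22 *v u)"
  by (simp add: vec_eq_iff matrix_vector_mult_def block_def vjoin_def sum_Plus_UNIV split: sum.split)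

lemma vjoin_add: "vjoin x u + vjoin y v = vjoin (x + y) (u + v)"
  by (simp add: vec_eq_iff vjoin_def split: sum.split)

lemma vjoin_scaleR: "c *\<^sub>R vjoin x u = vjoin (c *\<^sub>R x) (c *\<^sub>R u)"
  by (simp add: vec_eq_iff vjoin_def split: sum.split)

lemma vjoin_0 [simp]: "vjoin 0 0 = 0"
  by (simp add: vec_eq_iff vjoin_def split: sum.split)

lemma vjoin_gain_tendsto_0:
  fixes F :: "real^'n::finite^'m::finite"
  assumes "y \<longlonglongrightarrow> 0"
  shows "(\<lambda>k. vjoin (y k) (F *v y k)) \<longlonglongrightarrow> 0"
proof -
  have lin: "linear (\<lambda>y. vjoin y (F *v y))"
    by (rule linearI)
       (simp_all add: vjoin_add vjoin_scaleR matrix_vector_right_distrib matrix_vector_mult_scaleR)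
  show ?thesis
    using bounded_linear.tendsto[OF linear_conv_bounded_linear[THEN iffD1, OF lin] assms]
    by (simp add: linear_0[OF lin])
qed

lemma transpose_block: "transpose (block M11 M12 M21 M22)
   = block (transpose M11) (transpose M21) (transpose M12) (transpose M22)"
  by (simp add: vec_eq_iff transpose_def block_def split: sum.split)

lemma block12_block [simp]: "block12 (block M11 M12 M21 M22) = M12"
  by (simp add: vec_eq_iff block_def block12_def)

lemma block22_block [simp]: "block22 (block M11 M12 M21 M22) = M22"
  by (simp add: vec_eq_iff block_def block22_def)

lemma lower_mult_vjoin:
  assumes "transpose P = P"
  shows "lower (P *v vjoin x u) = transpose (block12 P) *v x + block22 P *v u"
proof -
  have "P $ i $ j = P $ j $ i" for i j
    using arg_cong[OF assms, of "\<lambda>M. M $ i $ j"] by (simp add: transpose_def)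
  then have "P $ Inr b $ Inl a = P $ Inl a $ Inr b" for a b by blast
  then show ?thesis
    by (simp add: vec_eq_iff lower_def matrix_vector_mult_def sum_Plus_UNIV vjoin_def
       block12_def block22_def transpose_def del: transpose_matrix_vector)
qed

lemma qf_vjoin_0: "qf P (vjoin 0 u) = qf (block22 P) u"
  by (simp add: qf_def inner_vjoin inner_vec_def upper_def lower_def matrix_vector_mult_def 
     sum_Plus_UNIV vjoin_def block22_def)

text \<open>
  The feedback that minimises \<open>v \<mapsto> qf P (vjoin y v)\<close> when the lower right block of \<open>P\<close> is
  positive definite. For \<open>P = 0\<close> the junk inverse is harmless, since the form is constant.
\<close>

definition gain :: "real^('n::finite + 'm::finite)^('n + 'm) \<Rightarrow> real^'n^'m" where
  "gain P = - (matrix_inv (block22 P) ** transpose (block12 P))"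

text \<open>
  For \<open>P\<close> in \<open>calP\<close> this is the quadratic form of the Schur complement of the lower right
  block of \<open>P\<close>.
\<close>

definition min_value :: "real^('n::finite + 'm::finite)^('n + 'm) \<Rightarrow> real^'n \<Rightarrow> real" where
  "min_value P y = qf P (vjoin y (gain P *v y))"

text \<open>
  The lower component of \<open>P *v vjoin y (gain P *v y)\<close>, which is half the gradient in the
  input, vanishes; so the cross term disappears when the input is shifted.
\<close>

lemma complete_square:
  assumes "transpose P = P" "pd (block22 P)"
  shows "qf P (vjoin y v) = min_value P y + qf (block22 P) (v - gain P *v y)"
proof -
  let ?g = "gain P *v y"
  have "block22 P *v ?g = - (transpose (block12 P) *v y)"
    by (simp add: gain_def uminus_matrix_vector matrix_vector_mul_assoc matrix_mul_assoc 
      pd_matrix_inv[OF assms(2)] vec.neg del: transpose_matrix_vector)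
  then have stationary: "lower (P *v vjoin y ?g) = 0"
    unfolding lower_mult_vjoin[OF assms(1)] by simp
  have "vjoin y v = vjoin y ?g + vjoin 0 (v - ?g)" by (simp add: vjoin_add)
  then show ?thesis
    using qf_shift[OF assms(1), of "vjoin y ?g" "vjoin 0 (v - ?g)"]
    by (simp add: min_value_def inner_vjoin stationary qf_vjoin_0)
qed

lemma min_value_le:
  assumes "P \<in> calP \<union> {0}"
  shows "min_value P y \<le> qf P (vjoin y v)"
proof (cases "P = 0")
  case False
  then have P: "transpose P = P" "pd (block22 P)" using assms by (auto simp: calP_def psd_def)
  show ?thesis
    using pd_imp_psd[OF P(2)] unfolding complete_square[OF P] psd_qf by simp
qed (simp add: min_value_def)

lemma calP_sym: "P \<in> calP \<union> {0} \<Longrightarrow> transpose P = P"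
  by (auto simp: calP_def psd_def transpose_def vec_eq_iff)

lemma calP_nonneg: "P \<in> calP \<union> {0} \<Longrightarrow> 0 \<le> qf P z"
  by (auto simp: calP_def psd_qf)

section \<open>Lyapunov equations and vanishing orbits\<close>

text \<open>
  The operator \<open>H \<mapsto> H - N\<^sup>T H N\<close> on the finite-dimensional space of matrices is injective: if
  \<open>H = N\<^sup>T H N\<close> then \<open>x \<bullet> H y = N\<^sup>k x \<bullet> H N\<^sup>k y\<close> for all \<open>k\<close>, which tends to \<open>0\<close>. Hence it is
  surjective.
\<close>

lemma lyapunov_solution:
  fixes N L :: "real^'k::finite^'k"
  assumes N: "\<And>z. (\<lambda>k. ((*v) N ^^ k) z) \<longlonglongrightarrow> 0"
  shows "\<exists>H. \<forall>z. qf H z = qf L z + qf H (N *v z)"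
proof -
  define \<Phi> where "\<Phi> H = H - transpose N ** H ** N" for H :: "real^'k^'k"
  have lin: "linear \<Phi>"
  proof (rule linearI)
    show "\<Phi> (H + G) = \<Phi> H + \<Phi> G" for H G
      by (simp add: \<Phi>_def matrix_eq matrix_vector_mul_assoc[symmetric] algebra_simps
         matrix_vector_mult_add_rdistrib matrix_vector_mult_diff_rdistrib matrix_vector_right_distrib
         del: transpose_matrix_vector)
    show "\<Phi> (c *\<^sub>R H) = c *\<^sub>R \<Phi> H" for c H
      by (simp add: \<Phi>_def matrix_scalar_ac scalar_matrix_assoc[symmetric] scaleR_diff_right)
  qed
  have "H = 0" if "\<Phi> H = 0" for H
  proof -
    have "H = transpose N ** H ** N" using that by (simp add: \<Phi>_def)
    then have inv: "x \<bullet> (H *v y) = (N *v x) \<bullet> (H *v (N *v y))" for x y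
      by (metis inner_transpose matrix_vector_mul_assoc)
    have iter: "x \<bullet> (H *v y) = (((*v) N ^^ k) x) \<bullet> (H *v (((*v) N ^^ k) y))" for x y k
      by (induction k) (use inv in auto)
    have "x \<bullet> (H *v y) = 0" for x y
    proof -
      have "(\<lambda>k. (((*v) N ^^ k) x) \<bullet> (H *v (((*v) N ^^ k) y))) \<longlonglongrightarrow> 0 \<bullet> (H *v 0)"
        by (intro tendsto_inner N bounded_linear.tendsto[OF matrix_vector_mul_bounded_linear])
      then show ?thesis unfolding iter[symmetric] by (simp add: LIMSEQ_const_iff)
    qed
    then show "H = 0"
      by (metis inner_eq_zero_iff matrix_eq matrix_vector_mult_0)
  qed
  then have "inj \<Phi>" unfolding linear_injective_0[OF lin] by blast
  then have "surj \<Phi>" using linear_injective_imp_surjective[OF lin] by blast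
  then obtain H where H: "\<Phi> H = L" by (metis surjD)
  have "qf H z = qf L z + qf H (N *v z)" for z
    unfolding H[symmetric] by (simp add: \<Phi>_def qf_diff qf_congruence)
  then show ?thesis by blast
qed

lemma qf_tendsto_0:
  fixes M :: "real^'k::finite^'k"
  assumes "x \<longlonglongrightarrow> 0"
  shows "(\<lambda>k. qf M (x k)) \<longlonglongrightarrow> 0"
proof -
  have "(\<lambda>k. x k \<bullet> (M *v x k)) \<longlonglongrightarrow> 0 \<bullet> (M *v 0)"
    by (intro tendsto_inner assms bounded_linear.tendsto[OF matrix_vector_mul_bounded_linear])
  then show ?thesis by (simp add: qf_def)
qed

text \<open>
  Used with a quadratic form \<open>f\<close> and a stable linear map \<open>g\<close>, where \<open>l = 0\<close>: a form that does
  not increase along a stable linear system is nonnegative.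
\<close>

lemma le_along_vanishing_orbit:
  fixes f :: "'a::topological_space \<Rightarrow> real"
  assumes "\<And>x. f (g x) \<le> f x" "(\<lambda>k. f ((g ^^ k) x)) \<longlonglongrightarrow> l"
  shows "l \<le> f x"
proof -
  have "f ((g ^^ k) x) \<le> f x" for k
    by (induction k) (use assms(1) order_trans in auto)
  then show ?thesis by (intro LIMSEQ_le_const2[OF assms(2)]) auto
qed

lemma tendsto_0_of_norm_square:
  fixes x :: "nat \<Rightarrow> 'a::real_normed_vector"
  assumes "(\<lambda>k. (norm (x k))\<^sup>2) \<longlonglongrightarrow> 0"
  shows "x \<longlonglongrightarrow> 0"
  using tendsto_real_sqrt[OF assms] by (intro tendsto_norm_zero_cancel[of x]) simp

lemma qf_le_sum_entries:
  fixes M :: "real^'k::finite^'k"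
  shows "qf M x \<le> (\<Sum>i\<in>UNIV. \<Sum>j\<in>UNIV. \<bar>M $ i $ j\<bar>) * (norm x)\<^sup>2"
proof -
  have "x $ i * (M $ i $ j * x $ j) \<le> \<bar>M $ i $ j\<bar> * (norm x)\<^sup>2" for i j
  proof -
    have "x $ i * (M $ i $ j * x $ j) \<le> \<bar>x $ i * (M $ i $ j * x $ j)\<bar>" by simp
    also have "\<dots> = \<bar>M $ i $ j\<bar> * (\<bar>x $ i\<bar> * \<bar>x $ j\<bar>)" by (simp add: abs_mult)
    also have "\<dots> \<le> \<bar>M $ i $ j\<bar> * (norm x * norm x)"
      by (intro mult_left_mono mult_mono component_le_norm_cart) auto
    finally show ?thesis by (simp add: power2_eq_square)
  qed
  then show ?thesis
    by (simp add: qf_def inner_vec_def matrix_vector_mult_def sum_distrib_left sum_distrib_right sum_mono)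
qed

section \<open>The Bellman operator\<close>

locale lq_problem =
  fixes A :: "real^'n::finite^'n" and B :: "real^'m::finite^'n" and \<gamma> :: real
    and Q :: "real^'n^'n" and R :: "real^'m^'m"
  assumes \<gamma>_pos: "0 < \<gamma>" and Q_psd: "psd Q" and R_pd: "pd R"
begin

abbreviation T where "T \<equiv> bellman A B \<gamma> Q R"

text \<open>
  The next state \<open>A x + B u\<close>; both \<open>closed_loop\<close> and \<open>bellman\<close> depend on \<open>z\<close> only through it,
  apart from the stage cost.
\<close>

definition successor :: "real^('n + 'm) \<Rightarrow> real^'n" where
  "successor z = A *v upper z + B *v lower z"

text \<open>
  Stability in the form in which it is used, with the discount absorbed into the state
  matrix: \<open>\<gamma> * qf X y = qf X (sqrt \<gamma> *\<^sub>R y)\<close>.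
\<close>

definition stabilizing :: "real^'n^'m \<Rightarrow> bool" where
  "stabilizing F \<longleftrightarrow> (\<forall>x. (\<lambda>k. ((*v) (sqrt \<gamma> *\<^sub>R (A + B ** F)) ^^ k) x) \<longlonglongrightarrow> 0)"

lemma Q_sym: "transpose Q = Q" and R_sym: "transpose R = R"
  using Q_psd R_pd by (auto simp: psd_def pd_def)

lemma Q_nonneg: "0 \<le> qf Q x" and R_nonneg: "0 \<le> qf R u"
  using Q_psd pd_imp_psd[OF R_pd] by (auto simp: psd_qf)

lemma Lam_sym: "transpose (Lam Q R) = Lam Q R"
  by (simp add: Lam_def transpose_block Q_sym R_sym)

lemma qf_Lam: "qf (Lam Q R) z = qf Q (upper z) + qf R (lower z)"
proof -
  have "qf (Lam Q R) (vjoin x u) = qf Q x + qf R u" for x u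
    by (simp add: qf_def Lam_def block_vjoin inner_vjoin)
  from this[of "upper z" "lower z"] show ?thesis by simp
qed

lemma Lam_nonneg: "0 \<le> qf (Lam Q R) z"
  by (simp add: qf_Lam Q_nonneg R_nonneg)

lemma closed_loop_apply: "closed_loop A B F *v z = vjoin (successor z) (F *v successor z)"
proof -
  have "closed_loop A B F *v vjoin x u = vjoin (successor (vjoin x u)) (F *v successor (vjoin x u))" for x u
    by (simp add: closed_loop_def block_vjoin successor_def matrix_vector_right_distrib
      matrix_vector_mul_assoc)
  from this[of "upper z" "lower z"] show ?thesis by simp
qed

lemma qf_bellman: "qf (T P) z = qf (Lam Q R) z + \<gamma> * min_value P (successor z)"
proof (cases "P = 0")
  case False
  then show ?thesis
    by (simp add: bellman_def Let_def gain_def[symmetric] qf_add qf_scaleR qf_congruence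
      closed_loop_apply min_value_def del: transpose_matrix_vector)
qed (simp add: bellman_def min_value_def)

lemma bellman_sym: "P \<in> calP \<union> {0} \<Longrightarrow> transpose (T P) = T P"
  unfolding bellman_def Let_def
  by (auto simp: transpose_add transpose_scalar Lam_sym transpose_congruence calP_sym)

text \<open>
  Dominating the stage cost \<open>\<Lambda>\<close> suffices for membership in \<open>calP\<close>, as the lower right block
  then dominates \<open>R\<close>.
\<close>

lemma calP_I:
  fixes P :: "real^('n + 'm)^('n + 'm)"
  assumes sym: "transpose P = P" and ge: "\<And>z. qf (Lam Q R) z \<le> qf P z"
  shows "P \<in> calP"
proof -
  have "psd P" unfolding psd_qf using sym ge Lam_nonneg order_trans by blast
  moreover have "transpose (block22 P) = block22 P"
    using sym by (simp add: vec_eq_iff transpose_def block22_def)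
  moreover have "0 < qf (block22 P) u" if "u \<noteq> 0" for u
  proof -
    have "0 < qf R u" using R_pd that by (simp add: pd_qf)
    also have "\<dots> = qf (Lam Q R) (vjoin 0 u)" by (simp add: qf_Lam)
    also have "\<dots> \<le> qf (block22 P) u" using ge[of "vjoin 0 u"] by (simp add: qf_vjoin_0)
    finally show ?thesis .
  qed
  ultimately show ?thesis by (simp add: calP_def pd_qf)
qed

lemma min_value_nonneg: "P \<in> calP \<union> {0} \<Longrightarrow> 0 \<le> min_value P y"
  unfolding min_value_def by (rule calP_nonneg)

lemma bellman_ge_Lam: "P \<in> calP \<union> {0} \<Longrightarrow> qf (Lam Q R) z \<le> qf (T P) z"
  using \<gamma>_pos min_value_nonneg[of P "successor z"] by (simp add: qf_bellman)

lemma bellman_calP: "P \<in> calP \<union> {0} \<Longrightarrow> T P \<in> calP"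
  using calP_I bellman_sym bellman_ge_Lam by blast

lemma bellman_pow_calP: "P \<in> calP \<union> {0} \<Longrightarrow> (T ^^ k) P \<in> calP \<union> {0}"
  by (induction k) (use bellman_calP in auto)

lemma bellman_mono:
  assumes "P \<in> calP \<union> {0}" "P' \<in> calP \<union> {0}" "\<And>z. qf P z \<le> qf P' z"
  shows "qf (T P) z \<le> qf (T P') z"
proof -
  have "min_value P y \<le> min_value P' y" for y
    using min_value_le[OF assms(1)] assms(3) unfolding min_value_def[of P'] by (rule order_trans)
  then show ?thesis using \<gamma>_pos by (simp add: qf_bellman)
qed

text \<open>
  The minimum over the inputs is at most the value at the input \<open>F *v y\<close>.
\<close>

lemma bellman_le_policy:
  assumes "P \<in> calP \<union> {0}"
  shows "qf (T P) z \<le> qf (Lam Q R) z + \<gamma> * qf P (closed_loop A B F *v z)"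
  using \<gamma>_pos min_value_le[OF assms] by (simp add: qf_bellman closed_loop_apply)

lemma bellman_pow_mono:
  assumes "P \<in> calP \<union> {0}" "P' \<in> calP \<union> {0}" "\<And>z. qf P z \<le> qf P' z"
  shows "qf ((T ^^ k) P) z \<le> qf ((T ^^ k) P') z"
  by (induction k arbitrary: z)
     (use assms bellman_mono bellman_pow_calP in auto)

text \<open>
  After one step every \<open>z\<close> lies in the graph of \<open>F\<close>, on which \<open>closed_loop A B F\<close> acts as
  \<open>A + B F\<close> on the state component.
\<close>

lemma stabilizing_closed_loop:
  assumes "stabilizing F"
  shows "(\<lambda>k. ((*v) (sqrt \<gamma> *\<^sub>R closed_loop A B F) ^^ k) z) \<longlonglongrightarrow> 0"
proof -
  let ?n = "sqrt \<gamma> *\<^sub>R (A + B ** F)" and ?N = "sqrt \<gamma> *\<^sub>R closed_loop A B F"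
  define y where "y k = ((*v) ?n ^^ k) (sqrt \<gamma> *\<^sub>R successor z)" for k
  have N: "?N *v z' = vjoin (sqrt \<gamma> *\<^sub>R successor z') (F *v (sqrt \<gamma> *\<^sub>R successor z'))" for z'
    by (simp add: scaleR_matrix_vector_assoc[symmetric] closed_loop_apply vjoin_scaleR
       matrix_vector_mult_scaleR)
  have succ: "sqrt \<gamma> *\<^sub>R successor (vjoin x (F *v x)) = ?n *v x" for x
    by (simp add: successor_def scaleR_matrix_vector_assoc[symmetric] matrix_vector_mult_add_rdistrib
      matrix_vector_mul_assoc)
  have "((*v) ?N ^^ Suc k) z = vjoin (y k) (F *v y k)" for k
    by (induction k) (simp_all add: N y_def succ)
  moreover have "y \<longlonglongrightarrow> 0" using assms unfolding y_def[abs_def] stabilizing_def by blast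
  ultimately have "(\<lambda>k. ((*v) ?N ^^ Suc k) z) \<longlonglongrightarrow> 0"
    using vjoin_gain_tendsto_0 by simp
  then show ?thesis by (rule LIMSEQ_imp_Suc)
qed

lemma qf_sqrt_closed_loop:
  "qf P ((sqrt \<gamma> *\<^sub>R closed_loop A B F) *v z) = \<gamma> * qf P (closed_loop A B F *v z)"
  using \<gamma>_pos by (simp add: scaleR_matrix_vector_assoc[symmetric] qf_scaleR_vector)

section \<open>Convergence of value iteration from zero\<close>

text \<open>
  The bound \<open>H\<close> is the infinite-horizon cost of the policy \<open>K\<close>. It satisfies
  \<open>H = \<Lambda> + \<gamma> A(K)\<^sup>T H A(K)\<close>, whereas \<open>T P\<close> is at most \<open>\<Lambda> + \<gamma> A(K)\<^sup>T P A(K)\<close>.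
\<close>

lemma value_iteration_bounded:
  assumes "stabilizing K"
  obtains H where "\<And>k z. qf ((T ^^ k) 0) z \<le> qf H z"
proof -
  let ?N = "sqrt \<gamma> *\<^sub>R closed_loop A B K"
  obtain H where H: "\<And>z. qf H z = qf (Lam Q R) z + qf H (?N *v z)"
    using lyapunov_solution[OF stabilizing_closed_loop[OF assms], of "Lam Q R"] by blast
  have H_step: "qf H (?N *v z) \<le> qf H z" for z using H[of z] Lam_nonneg[of z] by linarith
  have "0 \<le> qf H z" for z
    by (rule le_along_vanishing_orbit[OF H_step qf_tendsto_0[OF stabilizing_closed_loop[OF assms]]])
  then have "qf ((T ^^ k) 0) z \<le> qf H z" for k z
  proof (induction k arbitrary: z)
    case (Suc k)
    have "qf ((T ^^ Suc k) 0) z \<le> qf (Lam Q R) z + qf ((T ^^ k) 0) (?N *v z)"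
      using bellman_le_policy[OF bellman_pow_calP, of 0 k z K] by (simp add: qf_sqrt_closed_loop)
    also have "\<dots> \<le> qf H z" using Suc H[of z] by simp
    finally show ?case .
  qed simp
  then show ?thesis using that by blast
qed

text \<open>
  That the limit \<open>P\<close> of the increasing iterates is a fixed point is an interchange of a limit
  and a minimum. One inequality is monotonicity. For the other, the iterates beyond the first
  dominate \<open>\<Lambda>\<close>, so the minimising inputs are bounded through \<open>R\<close>, and on a bounded set the
  forms of the iterates converge uniformly to that of \<open>P\<close>.
\<close>

lemma value_iteration_converges:
  assumes "stabilizing K"
  obtains P where "P \<in> calP" "T P = P" "(\<lambda>k. (T ^^ k) 0) \<longlonglongrightarrow> P"
proof -
  define S where "S k = (T ^^ k) 0" for k
  have S_mem: "S k \<in> calP \<union> {0}" for k unfolding S_def by (rule bellman_pow_calP) simp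
  have S_Suc: "S (Suc k) = T (S k)" for k by (simp add: S_def)
  have S_inc: "qf (S k) z \<le> qf (S (Suc k)) z" for k z
    using bellman_pow_mono[of 0 "T 0" k z] bellman_calP[of 0] calP_nonneg[of "T 0"]
    unfolding S_def funpow_Suc_right o_def by simp
  obtain H where H: "\<And>k z. qf (S k) z \<le> qf H z"
    using value_iteration_bounded[OF assms] unfolding S_def by blast
  have conv: "convergent (\<lambda>k. qf (S k) z)" for z
    by (rule incseq_convergent[of "\<lambda>k. qf (S k) z" "qf H z"])
       (auto simp: incseq_Suc_iff S_inc H convergent_def)
  obtain P where P: "transpose P = P" "S \<longlonglongrightarrow> P" "\<And>z. (\<lambda>k. qf (S k) z) \<longlonglongrightarrow> qf P z"
    using symmetric_limit_exists[OF calP_sym[OF S_mem] conv] by blast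
  have S_le: "qf (S k) z \<le> qf P z" for k z
    by (rule incseq_le[OF _ P(3)]) (simp add: incseq_Suc_iff S_inc)
  have Lam_le_S: "qf (Lam Q R) z \<le> qf (S (Suc k)) z" for k z
    unfolding S_Suc by (rule bellman_ge_Lam[OF S_mem])
  have P_mem: "P \<in> calP"
    by (rule calP_I[OF P(1)]) (rule order_trans[OF Lam_le_S[of _ 0] S_le])
  have upper: "qf P z \<le> qf (T P) z" for z
  proof (rule LIMSEQ_le_const2[OF LIMSEQ_Suc[OF P(3)]], intro exI allI impI)
    fix k show "qf (S (Suc k)) z \<le> qf (T P) z"
      unfolding S_Suc by (rule bellman_mono[OF S_mem _ S_le]) (simp add: P_mem)
  qed
  have lower: "qf (T P) z \<le> qf P z" for z
  proof -
    define y where "y = successor z"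
    define v where "v k = gain (S k) *v y" for k
    define e where "e k = (\<Sum>i\<in>UNIV. \<Sum>j\<in>UNIV. \<bar>(P - S k) $ i $ j\<bar>)" for k
    obtain r where r: "0 < r" "\<And>u. r * (norm u)\<^sup>2 \<le> qf R u"
      using pd_bounded_below[OF R_pd] by blast
    \<comment> \<open>bounds the squared norm of the stacked vector at a minimising input: comparing with the
      input 0 gives \<open>r * (norm v)\<^sup>2 \<le> qf P (vjoin y 0)\<close>\<close>
    define b where "b = (norm y)\<^sup>2 + qf P (vjoin y 0) / r"
    have min_S: "min_value (S k) y = qf (S k) (vjoin y (v k))" for k
      by (simp add: min_value_def v_def)
    have b: "(norm (vjoin y (v (Suc k))))\<^sup>2 \<le> b" for k
    proof -
      have "r * (norm (v (Suc k)))\<^sup>2 \<le> qf R (v (Suc k))" by (rule r(2))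
      also have "\<dots> \<le> qf (Lam Q R) (vjoin y (v (Suc k)))" by (simp add: qf_Lam Q_nonneg)
      also have "\<dots> \<le> min_value (S (Suc k)) y" unfolding min_S by (rule Lam_le_S)
      also have "\<dots> \<le> qf (S (Suc k)) (vjoin y 0)" by (rule min_value_le[OF S_mem])
      also have "\<dots> \<le> qf P (vjoin y 0)" by (rule S_le)
      finally have "(norm (v (Suc k)))\<^sup>2 \<le> qf P (vjoin y 0) / r"
        using r(1) by (simp add: field_simps)
      moreover have "(norm (vjoin y u))\<^sup>2 = (norm y)\<^sup>2 + (norm u)\<^sup>2" for u :: "real^'m"
        by (simp add: power2_norm_eq_inner inner_vjoin)
      ultimately show ?thesis by (simp add: b_def)
    qed
    have e_nonneg: "0 \<le> e k" for k by (simp add: e_def sum_nonneg)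
    have "(\<lambda>k. e (Suc k)) \<longlonglongrightarrow> (\<Sum>i\<in>(UNIV::('n+'m) set). \<Sum>j\<in>(UNIV::('n+'m) set). \<bar>(P - P) $ i $ j\<bar>)"
      unfolding e_def vector_minus_component
      by (intro tendsto_sum tendsto_rabs tendsto_diff tendsto_const tendsto_vec_nth LIMSEQ_Suc[OF P(2)])
    then have e0: "(\<lambda>k. e (Suc k)) \<longlonglongrightarrow> 0" by simp
    have "qf (T P) z \<le> qf P z + \<gamma> * (e (Suc k) * b)" for k
    proof -
      let ?z = "vjoin y (v (Suc k))"
      have "min_value P y \<le> qf P ?z" by (rule min_value_le) (simp add: P_mem)
      also have "\<dots> = qf (S (Suc k)) ?z + qf (P - S (Suc k)) ?z" by (simp add: qf_diff)
      also have "\<dots> \<le> min_value (S (Suc k)) y + e (Suc k) * b"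
        unfolding min_S using qf_le_sum_entries[of "P - S (Suc k)" ?z]
          mult_left_mono[OF b[of k] e_nonneg[of "Suc k"]] by (simp add: e_def)
      finally have "\<gamma> * min_value P y \<le> \<gamma> * min_value (S (Suc k)) y + \<gamma> * (e (Suc k) * b)"
        using \<gamma>_pos by (simp flip: distrib_left)
      moreover have "qf (Lam Q R) z + \<gamma> * min_value (S (Suc k)) y \<le> qf P z"
        using S_le[of "Suc (Suc k)" z] unfolding S_Suc[of "Suc k"] qf_bellman y_def .
      ultimately show ?thesis by (simp add: qf_bellman y_def)
    qed
    moreover have "(\<lambda>k. qf P z + \<gamma> * (e (Suc k) * b)) \<longlonglongrightarrow> qf P z + \<gamma> * (0 * b)"
      by (intro tendsto_intros e0)
    ultimately show ?thesis using LIMSEQ_le_const[of _ "qf P z" "qf (T P) z"] by simp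
  qed
  have "T P = P"
    by (rule symmetric_eqI[OF bellman_sym P(1)]) (use P_mem upper lower order_antisym in auto)
  then show ?thesis using that P_mem P(2) unfolding S_def[abs_def] by blast
qed

end

section \<open>The Riccati equation\<close>

context lq_problem
begin

text \<open>
  The cost of an arbitrary input now, followed by the state cost \<open>X\<close>: \<open>qf_q_matrix\<close>. At the
  Riccati solution this is the matrix \<open>P_star\<close>.
\<close>

definition q_matrix :: "real^'n^'n \<Rightarrow> real^('n + 'm)^('n + 'm)" where
  "q_matrix X =
     block (Q + \<gamma> *\<^sub>R (transpose A ** X ** A)) (\<gamma> *\<^sub>R (transpose A ** X ** B))
           (\<gamma> *\<^sub>R (transpose B ** X ** A)) (R + \<gamma> *\<^sub>R (transpose B ** X ** B))"

lemma q_matrix_sym: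
  assumes "transpose X = X"
  shows "transpose (q_matrix X) = q_matrix X"
  by (simp add: q_matrix_def transpose_block transpose_add transpose_scalar Q_sym R_sym
    transpose_sandwich[OF assms])

lemma q_matrix_apply:
  "q_matrix X *v z = Lam Q R *v z
     + \<gamma> *\<^sub>R vjoin (transpose A *v (X *v successor z)) (transpose B *v (X *v successor z))"
proof -
  have "q_matrix X *v vjoin x u = Lam Q R *v vjoin x u
     + \<gamma> *\<^sub>R vjoin (transpose A *v (X *v successor (vjoin x u)))
         (transpose B *v (X *v successor (vjoin x u)))" for x u
    by (simp add: q_matrix_def Lam_def block_vjoin successor_def vjoin_add vjoin_scaleR
       matrix_vector_mult_add_rdistrib matrix_vector_right_distrib scaleR_matrix_vector_assoc[symmetric]
       matrix_vector_mul_assoc scaleR_add_right matrix_mul_assoc algebra_simps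
       del: transpose_matrix_vector)
  from this[of "upper z" "lower z"] show ?thesis by simp
qed

lemma qf_q_matrix: "qf (q_matrix X) z = qf (Lam Q R) z + \<gamma> * qf X (successor z)"
proof -
  have "vjoin x u \<bullet> vjoin (transpose A *v w) (transpose B *v w) = successor (vjoin x u) \<bullet> w" for x u w
    by (simp add: inner_vjoin inner_transpose successor_def inner_add_left del: transpose_matrix_vector)
  from this[of "upper z" "lower z"] show ?thesis
    unfolding qf_def q_matrix_apply by (simp add: inner_add_right)
qed

lemma q_matrix_calP:
  assumes "psd X"
  shows "q_matrix X \<in> calP"
  using assms \<gamma>_pos by (intro calP_I q_matrix_sym) (auto simp: psd_qf qf_q_matrix)

lemma q_matrix_pd22: "psd X \<Longrightarrow> pd (R + \<gamma> *\<^sub>R (transpose B ** X ** B))"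
  using q_matrix_calP[of X] by (simp add: calP_def q_matrix_def)

lemma gain_q_matrix:
  assumes "transpose X = X"
  shows "gain (q_matrix X) = - (matrix_inv (R + \<gamma> *\<^sub>R (transpose B ** X ** B))
     ** (\<gamma> *\<^sub>R (transpose B ** X ** A)))"
  by (simp add: gain_def q_matrix_def transpose_scalar transpose_sandwich[OF assms])

text \<open>
  The right-hand side of the Riccati equation is the Schur complement of \<open>q_matrix X\<close>, so the
  equation says that the optimal one-stage cost with terminal cost \<open>X\<close> is again \<open>X\<close>.
\<close>

lemma riccati_eq_iff_min_value:
  assumes X: "psd X"
  shows "riccati_eq A B \<gamma> Q R X \<longleftrightarrow> (\<forall>y. min_value (q_matrix X) y = qf X y)"
proof -
  let ?E = "\<gamma> *\<^sub>R (transpose A ** X ** A)" and ?G = "\<gamma> *\<^sub>R (transpose A ** X ** B)"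
    and ?G' = "\<gamma> *\<^sub>R (transpose B ** X ** A)" and ?D = "R + \<gamma> *\<^sub>R (transpose B ** X ** B)"
  define Z where "Z = ?E - ?G ** matrix_inv ?D ** ?G' + Q"
  have symX: "transpose X = X" using X by (simp add: psd_def)
  note D = q_matrix_pd22[OF X]
  have symZ: "transpose Z = Z"
    by (simp add: Z_def transpose_add transpose_diff transpose_scalar transpose_sandwich[OF symX]
      matrix_transpose_mul[of "?G ** matrix_inv ?D"] matrix_transpose_mul[of ?G] 
      transpose_matrix_inv_pd[OF D] Q_sym matrix_mul_assoc)
  have "min_value (q_matrix X) y = qf Z y" for y
  proof -
    let ?v = "matrix_inv ?D *v (?G' *v y)"
    have g: "gain (q_matrix X) *v y = - ?v"
      by (simp add: gain_q_matrix[OF symX] uminus_matrix_vector matrix_vector_mul_assoc)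
    have "?D *v ?v = ?G' *v y"
      unfolding matrix_vector_mul_assoc matrix_mul_assoc pd_matrix_inv[OF D] by simp
    then have "q_matrix X *v vjoin y (- ?v) = vjoin ((Q + ?E) *v y - ?G *v ?v) 0"
      by (simp only: q_matrix_def block_vjoin vec.neg) simp
    also have "(Q + ?E) *v y - ?G *v ?v = Z *v y"
      by (simp add: Z_def matrix_vector_mult_add_rdistrib matrix_vector_mult_diff_rdistrib
        matrix_vector_mul_assoc matrix_mul_assoc)
    finally have "q_matrix X *v vjoin y (- ?v) = vjoin (Z *v y) 0" .
    then show ?thesis by (simp add: min_value_def g qf_def inner_vjoin)
  qed
  moreover have "riccati_eq A B \<gamma> Q R X \<longleftrightarrow> X = Z" by (simp add: riccati_eq_def Z_def)
  ultimately show ?thesis using symmetric_eqI[OF symX symZ] by metis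
qed

lemma bellman_q_matrix:
  assumes "psd X" "riccati_eq A B \<gamma> Q R X"
  shows "T (q_matrix X) = q_matrix X"
proof (rule symmetric_eqI)
  have "q_matrix X \<in> calP" by (rule q_matrix_calP[OF assms(1)])
  then show "transpose (T (q_matrix X)) = T (q_matrix X)" by (intro bellman_sym) simp
  show "transpose (q_matrix X) = q_matrix X" using assms(1) by (intro q_matrix_sym) (simp add: psd_def)
  show "qf (T (q_matrix X)) z = qf (q_matrix X) z" for z
    using assms by (simp add: riccati_eq_iff_min_value qf_bellman qf_q_matrix)
qed

text \<open>
  Take for \<open>X\<close> the Schur complement of \<open>P\<close>, written as the congruence \<open>J\<^sup>T P J\<close> with the graph
  map \<open>J\<close> of the gain, which makes it symmetric and positive semidefinite. The fixed point
  equation then reads \<open>P = q_matrix X\<close>.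
\<close>

lemma riccati_of_fixed_point:
  assumes P: "P \<in> calP" "T P = P"
  obtains X where "psd X" "riccati_eq A B \<gamma> Q R X" "P = q_matrix X"
proof -
  define J where "J = matrix (\<lambda>y. vjoin y (gain P *v y))"
  define X where "X = transpose J ** P ** J"
  have symP: "transpose P = P" using P(1) by (intro calP_sym) simp
  have "linear (\<lambda>y. vjoin y (gain P *v y))"
    by (rule linearI)
       (simp_all add: vjoin_add vjoin_scaleR matrix_vector_right_distrib matrix_vector_mult_scaleR)
  then have qf_X: "qf X y = min_value P y" for y
    unfolding X_def qf_congruence by (simp add: J_def matrix_works min_value_def)
  have symX: "transpose X = X" unfolding X_def by (rule transpose_congruence[OF symP])
  have X: "psd X" using min_value_nonneg[of P] P(1) by (simp add: psd_qf symX qf_X)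
  have PX: "P = q_matrix X"
    by (rule symmetric_eqI[OF symP q_matrix_sym[OF symX]])
       (subst P(2)[symmetric], simp add: qf_bellman qf_q_matrix qf_X)
  then have "riccati_eq A B \<gamma> Q R X"
    unfolding riccati_eq_iff_min_value[OF X] using qf_X by simp
  then show ?thesis using that X PX by blast
qed

lemma successor_policy: "successor (vjoin x (F *v x)) = (A + B ** F) *v x"
  by (simp add: successor_def matrix_vector_mult_add_rdistrib matrix_vector_mul_assoc)

lemma qf_sqrt_state_loop:
  "qf X ((sqrt \<gamma> *\<^sub>R (A + B ** F)) *v x) = \<gamma> * qf X ((A + B ** F) *v x)"
  using \<gamma>_pos by (simp add: scaleR_matrix_vector_assoc[symmetric] qf_scaleR_vector)

lemma riccati_closed_loop_cost:
  assumes "psd X" "riccati_eq A B \<gamma> Q R X"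
  defines "F \<equiv> gain (q_matrix X)"
  shows "qf X x = qf Q x + qf R (F *v x) + qf X ((sqrt \<gamma> *\<^sub>R (A + B ** F)) *v x)"
proof -
  have "qf X x = qf (q_matrix X) (vjoin x (F *v x))"
    using assms by (simp add: riccati_eq_iff_min_value min_value_def)
  then show ?thesis by (simp add: qf_q_matrix qf_Lam successor_policy qf_sqrt_state_loop)
qed

lemma riccati_policy_cost:
  assumes "psd X" "riccati_eq A B \<gamma> Q R X"
  shows "qf X x \<le> qf Q x + qf R (F *v x) + qf X ((sqrt \<gamma> *\<^sub>R (A + B ** F)) *v x)"
proof -
  have "qf X x = min_value (q_matrix X) x"
    using assms by (simp add: riccati_eq_iff_min_value)
  also have "\<dots> \<le> qf (q_matrix X) (vjoin x (F *v x))"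
    using q_matrix_calP[OF assms(1)] by (intro min_value_le) simp
  finally show ?thesis by (simp add: qf_q_matrix qf_Lam successor_policy qf_sqrt_state_loop)
qed

text \<open>
  Along the closed loop \<open>qf X (x k)\<close> decreases by the stage cost \<open>d k\<close> and is bounded below, so
  the stage costs vanish. They control \<open>C x\<close> and, through \<open>R\<close>, the input \<open>F x\<close>, which makes the
  trajectory a driven trajectory of the stable matrix \<open>A + L C\<close> with vanishing input.
\<close>

lemma riccati_stabilizing:
  fixes C :: "real^'n^'p::finite"
  assumes "\<gamma> \<le> 1" "Q = transpose C ** C" "detectable A C"
    and X: "psd X" "riccati_eq A B \<gamma> Q R X"
  shows "stabilizing (gain (q_matrix X))"
  unfolding stabilizing_def
proof
  fix x0
  define F where "F = gain (q_matrix X)"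
  let ?n = "sqrt \<gamma> *\<^sub>R (A + B ** F)"
  define x where "x k = ((*v) ?n ^^ k) x0" for k
  have x_Suc: "x (Suc k) = ?n *v x k" for k by (simp add: x_def)
  define d where "d k = qf Q (x k) + qf R (F *v x k)" for k
  have cost: "qf X (x k) = d k + qf X (x (Suc k))" for k
    unfolding d_def x_Suc F_def by (rule riccati_closed_loop_cost[OF X])
  have d_nonneg: "0 \<le> d k" for k by (simp add: d_def Q_nonneg R_nonneg)
  have "convergent (\<lambda>k. qf X (x k))"
  proof (rule decseq_convergent[of _ 0])
    show "decseq (\<lambda>k. qf X (x k))" unfolding decseq_Suc_iff
    proof
      fix k show "qf X (x (Suc k)) \<le> qf X (x k)" using cost[of k] d_nonneg[of k] by linarith
    qed
  qed (use X(1) in \<open>auto simp: psd_qf convergent_def\<close>)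
  then obtain l where l: "(\<lambda>k. qf X (x k)) \<longlonglongrightarrow> l" by (auto simp: convergent_def)
  have "(\<lambda>k. qf X (x k) - qf X (x (Suc k))) \<longlonglongrightarrow> l - l"
    by (intro tendsto_diff l LIMSEQ_Suc[OF l])
  moreover have "qf X (x k) - qf X (x (Suc k)) = d k" for k using cost[of k] by linarith
  ultimately have d0: "d \<longlonglongrightarrow> 0" by simp
  have "qf Q y = (norm (C *v y))\<^sup>2" for y
    by (simp add: assms(2) qf_def matrix_vector_mul_assoc[symmetric] inner_transpose
      power2_norm_eq_inner del: transpose_matrix_vector)
  then have C_le: "(norm (C *v x k))\<^sup>2 \<le> d k" for k by (simp add: d_def R_nonneg)
  have "(\<lambda>k. (norm (C *v x k))\<^sup>2) \<longlonglongrightarrow> 0"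
    by (rule Lim_null_comparison[OF _ d0]) (use C_le in simp)
  then have C0: "(\<lambda>k. C *v x k) \<longlonglongrightarrow> 0"
    by (rule tendsto_0_of_norm_square)
  obtain r where r: "0 < r" "\<And>u. r * (norm u)\<^sup>2 \<le> qf R u"
    using pd_bounded_below[OF R_pd] by blast
  have F_le: "(norm (F *v x k))\<^sup>2 \<le> d k / r" for k
    using r(2)[of "F *v x k"] r(1) Q_nonneg[of "x k"] by (simp add: d_def field_simps)
  have "(\<lambda>k. d k / r) \<longlonglongrightarrow> 0" using tendsto_divide[OF d0 tendsto_const[of r]] r(1) by simp
  then have "(\<lambda>k. (norm (F *v x k))\<^sup>2) \<longlonglongrightarrow> 0"
    by (rule Lim_null_comparison[rotated]) (use F_le in simp)
  then have F0: "(\<lambda>k. F *v x k) \<longlonglongrightarrow> 0"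
    by (rule tendsto_0_of_norm_square)
  obtain L where L: "schur_stable (A + L ** C)" using assms(3) by (auto simp: detectable_def)
  define w where "w k = sqrt \<gamma> *\<^sub>R (B *v (F *v x k) - L *v (C *v x k))" for k
  have "w \<longlonglongrightarrow> sqrt \<gamma> *\<^sub>R (B *v 0 - L *v 0)"
    unfolding w_def
    by (intro tendsto_scaleR tendsto_const tendsto_diff C0 F0
       bounded_linear.tendsto[OF matrix_vector_mul_bounded_linear])
  then have w0: "w \<longlonglongrightarrow> 0" by simp
  have x_step: "x (Suc k) = (sqrt \<gamma> *\<^sub>R (A + L ** C)) *v x k + w k" for k
    by (simp add: x_Suc w_def scaleR_matrix_vector_assoc[symmetric] matrix_vector_mult_add_rdistrib
      matrix_vector_mul_assoc algebra_simps)
  have "schur_stable (sqrt \<gamma> *\<^sub>R (A + L ** C))"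
    using \<gamma>_pos assms(1) by (intro schur_stable_scaleR[OF L]) auto
  then have "x \<longlonglongrightarrow> 0" by (rule schur_stable_vanishing_input[OF _ x_step w0])
  then show "(\<lambda>k. ((*v) (sqrt \<gamma> *\<^sub>R (A + B ** gain (q_matrix X))) ^^ k) x0) \<longlonglongrightarrow> 0"
    unfolding x_def[abs_def] F_def .
qed

text \<open>
  Along the closed loop of \<open>Y\<close> the stage costs exhaust \<open>Y\<close>, while \<open>X\<close> cannot decrease by more
  than the stage cost. So \<open>Y - X\<close> does not increase along a stable orbit.
\<close>

lemma riccati_le:
  assumes X: "psd X" "riccati_eq A B \<gamma> Q R X" and Y: "psd Y" "riccati_eq A B \<gamma> Q R Y"
    and stab: "stabilizing (gain (q_matrix Y))"
  shows "qf X x \<le> qf Y x"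
proof -
  let ?n = "sqrt \<gamma> *\<^sub>R (A + B ** gain (q_matrix Y))"
  have step: "qf (Y - X) (?n *v x) \<le> qf (Y - X) x" for x
    using riccati_policy_cost[OF X, of x "gain (q_matrix Y)"] riccati_closed_loop_cost[OF Y, of x]
    unfolding qf_diff by linarith
  have "(\<lambda>k. ((*v) ?n ^^ k) x) \<longlonglongrightarrow> 0" using stab by (simp add: stabilizing_def)
  from le_along_vanishing_orbit[OF step qf_tendsto_0[OF this]] have "0 \<le> qf (Y - X) x" .
  then show ?thesis by (simp add: qf_diff)
qed

section \<open>The error bounds of value iteration\<close>

text \<open>
  The gain of \<open>q_matrix X\<close> is optimal at the fixed point and merely admissible at the iterates
  from \<open>P\<close>; subtracting gives one step of the bound. The difference \<open>P - q_matrix X\<close> may be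
  indefinite, as only the form itself is propagated.
\<close>

lemma bellman_pow_diff_le:
  assumes P: "P \<in> calP \<union> {0}" and X: "psd X" "riccati_eq A B \<gamma> Q R X"
  defines "N \<equiv> sqrt \<gamma> *\<^sub>R closed_loop A B (gain (q_matrix X))"
  shows "qf ((T ^^ k) P) z - qf (q_matrix X) z \<le> qf (P - q_matrix X) (((*v) N ^^ k) z)"
proof (induction k arbitrary: z)
  case 0 show ?case by (simp add: qf_diff)
next
  case (Suc k)
  let ?F = "gain (q_matrix X)"
  have "qf ((T ^^ Suc k) P) z \<le> qf (Lam Q R) z + qf ((T ^^ k) P) (N *v z)"
    using bellman_le_policy[OF bellman_pow_calP[OF P], of k z ?F]
    unfolding N_def qf_sqrt_closed_loop by simp
  moreover have "qf (q_matrix X) z = qf (Lam Q R) z + qf (q_matrix X) (N *v z)"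
    unfolding N_def qf_sqrt_closed_loop closed_loop_apply min_value_def[symmetric]
    using qf_bellman[of "q_matrix X" z] bellman_q_matrix[OF X] by simp
  ultimately show ?case using Suc[of "N *v z"] by (simp add: funpow_swap1)
qed

end

lemma matpow_Suc_right: "matpow M (Suc k) = matpow M k ** M"
  by (induction k) (simp_all add: matrix_mul_assoc)

lemma matpow_transpose: "matpow (transpose M) k = transpose (matpow M k)"
proof (induction k)
  case (Suc k)
  have "matpow (transpose M) (Suc k) = transpose (matpow M k ** M)"
    by (simp add: Suc matrix_transpose_mul)
  then show ?case unfolding matpow_Suc_right .
qed simp

lemma scaled_orbit: "((*v) (c *\<^sub>R M) ^^ k) x = c ^ k *\<^sub>R (matpow M k *v x)"
  by (induction k)
     (simp_all add: scaleR_matrix_vector_assoc[symmetric] matrix_vector_mult_scaleR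
       matrix_vector_mul_assoc[symmetric])

lemma qf_power_congruence:
  assumes "0 \<le> \<gamma>"
  shows "qf (\<gamma> ^ k *\<^sub>R (matpow (transpose M) k ** D ** matpow M k)) z
    = qf D (((*v) (sqrt \<gamma> *\<^sub>R M) ^^ k) z)"
proof -
  have "(sqrt \<gamma> ^ k)\<^sup>2 = \<gamma> ^ k"
    using assms by (metis mult.commute power_mult real_sqrt_pow2)
  then show ?thesis
    by (simp add: matpow_transpose qf_scaleR qf_congruence scaled_orbit qf_scaleR_vector)
qed

theorem theorem4:
  fixes A :: "real^'n::finite^'n" and B :: "real^'m::finite^'n" and C :: "real^'n^'p"
    and Q :: "real^'n^'n" and R :: "real^'m^'m" and \<gamma> :: real
    and P :: "real^('n + 'm)^('n + 'm)"
  assumes "0 < \<gamma>" and "\<gamma> \<le> 1"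
    and "psd Q" and "pd R"
    and "stabilizable A B"
    and "Q = transpose C ** C" and "detectable A C"
    and "P \<in> calP \<union> {0}"
  shows "let T = bellman A B \<gamma> Q R;
             Ps = P_star A B \<gamma> Q R;
             M = closed_loop A B (F_star A B \<gamma> Q R);
             U = (\<lambda>k. \<gamma> ^ k *\<^sub>R (matpow (transpose M) k ** (P - Ps) ** matpow M k))
         in (\<forall>k. (T ^^ k) 0 - (T ^^ k) Ps \<preceq> (T ^^ k) P - (T ^^ k) Ps
               \<and> (T ^^ k) P - (T ^^ k) Ps \<preceq> U k)
          \<and> U \<longlonglongrightarrow> 0
          \<and> (\<lambda>k. (T ^^ k) 0 - (T ^^ k) Ps) \<longlonglongrightarrow> 0"
proof -
  interpret lq_problem A B \<gamma> Q R by unfold_locales (use assms in auto)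
  obtain K where K: "schur_stable (A + B ** K)" using assms(5) by (auto simp: stabilizable_def)
  have "schur_stable (sqrt \<gamma> *\<^sub>R (A + B ** K))"
    using assms(1,2) by (intro schur_stable_scaleR[OF K]) auto
  then have "stabilizing K"
    unfolding stabilizing_def
    by (intro allI, elim schur_stable_vanishing_input[where w = "\<lambda>_. 0"]) simp_all
  then obtain Pinf where Pinf: "Pinf \<in> calP" "T Pinf = Pinf" "(\<lambda>k. (T ^^ k) 0) \<longlonglongrightarrow> Pinf"
    by (rule value_iteration_converges)
  obtain X where X: "psd X" "riccati_eq A B \<gamma> Q R X" and PX: "Pinf = q_matrix X"
    using riccati_of_fixed_point[OF Pinf(1,2)] by blast
  have stab: "stabilizing (gain (q_matrix Y))" if "psd Y" "riccati_eq A B \<gamma> Q R Y" for Y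
    by (rule riccati_stabilizing[OF assms(2,6,7) that])
  have symX: "transpose X = X" using X(1) by (simp add: psd_def)
  have "X_star A B \<gamma> Q R = X"
    unfolding X_star_def
  proof (rule the_equality)
    fix Y assume "psd Y \<and> riccati_eq A B \<gamma> Q R Y"
    then have Y: "psd Y" "riccati_eq A B \<gamma> Q R Y" by auto
    have "transpose Y = Y" using Y(1) by (simp add: psd_def)
    moreover have "qf Y x = qf X x" for x
      using riccati_le[OF X Y stab[OF Y], of x] riccati_le[OF Y X stab[OF X], of x] by linarith
    ultimately show "Y = X" by (rule symmetric_eqI[OF _ symX])
  qed (use X in blast)
  then have Ps: "P_star A B \<gamma> Q R = q_matrix X"
    and Fs: "F_star A B \<gamma> Q R = gain (q_matrix X)"
    by (simp_all add: P_star_def F_star_def Let_def q_matrix_def[symmetric] gain_q_matrix[OF symX])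
  define M where "M = closed_loop A B (gain (q_matrix X))"
  define U where "U k = \<gamma> ^ k *\<^sub>R (matpow (transpose M) k ** (P - q_matrix X) ** matpow M k)" for k
  have fixed: "(T ^^ k) (q_matrix X) = q_matrix X" for k
    by (induction k) (simp_all add: bellman_q_matrix[OF X])
  have symD: "transpose (P - q_matrix X) = P - q_matrix X"
    by (simp add: transpose_diff calP_sym[OF assms(8)] q_matrix_sym[OF symX])
  have symU: "transpose (U k) = U k" for k
    by (simp add: U_def transpose_scalar matpow_transpose transpose_congruence[OF symD])
  have qf_U: "qf (U k) z = qf (P - q_matrix X) (((*v) (sqrt \<gamma> *\<^sub>R M) ^^ k) z)" for k z
    unfolding U_def using assms(1) by (intro qf_power_congruence) simp
  have symT: "transpose ((T ^^ k) P' - q_matrix X) = (T ^^ k) P' - q_matrix X"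
    if "P' \<in> calP \<union> {0}" for k P'
    by (simp add: transpose_diff calP_sym[OF bellman_pow_calP[OF that]] q_matrix_sym[OF symX])
  have "(T ^^ k) 0 - q_matrix X \<preceq> (T ^^ k) P - q_matrix X" for k
    using bellman_pow_mono[OF _ assms(8), of 0 k] calP_nonneg[OF assms(8)]
    by (subst loewner_qf[OF symT symT[OF assms(8)]]) (auto simp: qf_diff)
  moreover have "(T ^^ k) P - q_matrix X \<preceq> U k" for k
    using bellman_pow_diff_le[OF assms(8) X, of k]
    by (subst loewner_qf[OF symT[OF assms(8)] symU]) (auto simp: qf_U qf_diff M_def)
  moreover have "U \<longlonglongrightarrow> 0"
    by (rule symmetric_tendstoI)
       (use qf_tendsto_0[OF stabilizing_closed_loop[OF stab[OF X]]] in
          \<open>simp_all add: symU qf_U M_def\<close>)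
  moreover have "(\<lambda>k. (T ^^ k) 0 - q_matrix X) \<longlonglongrightarrow> 0"
    using tendsto_diff[OF Pinf(3) tendsto_const[of Pinf]] by (simp add: PX)
  ultimately show ?thesis
    unfolding Let_def Ps Fs fixed M_def[symmetric] U_def[symmetric] by blast
qed

end
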